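(* Let $\nu,\beta\in]0,+\infty[$, $t_0\in]0,+\infty]$ and $p\in[1,+\infty[$. Let $\mathbf X$ be the Hunt process on $E$ with semigroup kernel $p_t(x,y)$ described in the context, and let $\mu$ be a positive Radon measure on $E$. Assume that there exist constants $C,r_0>0$ and $\eta\in]0,\nu]$ satisfying $\eta-p(\nu-\beta)>0$ such that $\mu(B_r(x))\le Cr^\eta$ for any $x\in E$ and $r\in]0,r_0[$. Suppose that there exists a positive decreasing function $\Phi_2$ on $[0,+\infty[$ (which may depend on $t_0$ if $t_0<+\infty$) satisfying $$\int_1^\infty t^{\nu-1}\Phi_2(t)\,dt<+\infty$$ and, for any $x,y\in E$ and $t\in]0,t_0[$, $$p_t(x,y)\le\frac{1}{t^{\nu/\beta}}\Phi_2\Big(\frac{d(x,y)}{t^{1/\beta}}\Big).$$ Then we have the following: (1) Suppose $\mu(E)<+\infty$. Then $\mu\in S_K^{\,p,\delta}$ for any $\delta\in]0,\frac{\eta-p(\nu-\beta)}{p\beta}[$. (2) Suppose $p>1$ and $\mu\in S_D$. If $p\in[\frac{\eta+\beta}{\nu},\frac{\eta}{(\nu-\beta)_+}[$, then $\mu\in S_K^{\,p,\delta}$ for any $\delta\in]0,\frac{\eta-p(\nu-\beta)}{p\beta}[$; if $p\in]1,\frac{\eta+\beta}{\nu}[$, then $\mu\in S_K^{\,p,\delta}$ for any $\delta\in]0,\frac{(p-1)(\eta-p(\nu-\beta))}{p^2\beta}[$. Here $\eta/(\nu-\beta)_+:=\eta/(\nu-\beta)$ for $\nu>\beta$ and $\eta/(\nu-\beta)_+:=+\infty$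 for $\nu\le\beta$. (3) Suppose $p>1$ and $\mu\in S_D$. Assume further that either there exists $C>0$ such that $\sup_{x\in E}\mu(B_r(x))\le Cr^\eta$ holds for any $r\in]0,+\infty[$, or $\int_1^\infty u^{\nu+\gamma-1}\Phi_2(u)\,du<+\infty$ holds for any $\gamma>0$. Then $\mu\in S_K^{\,p,\delta}$ for any $\delta\in]0,\frac{\eta-p(\nu-\beta)}{p\beta}[$.
   Context: Notation: $]a,b[$ denotes an open interval; "decreasing" is in the wide (non-strict) sense. Setting. $(E,d)$ is a locally compact separable metric space, $\mathfrak m$ is a positive Radon measure on $E$ with full support, $B_r(x)=\{y\in E: d(x,y)<r\}$. $(\mathscr E,\mathscr F)$ is a symmetric regular Dirichlet form on $L^2(E;\mathfrak m)$, and $\mathbf X=(\Omega,X_t,\zeta,\mathbf P_x)$ is an associated Hunt process. It is assumed that there is a jointly measurable nonnegative function $p_t(x,y)$, $(t,x,y)\in]0,+\infty[\times E\times E$ (semigroup kernel, or heat kernel) with $\mathbf E_x[u(X_t)]=\int_E p_t(x,y)u(y)\,\mathfrak m(dy)$ for all $x\in E$, $t>0$ and bounded Borel $u$; moreover $p_{t+s}(x,y)=\int_E p_s(x,z)p_t(z,y)\,\mathfrak m(dz)$ for all $x,y\in E$, $s,t>0$, and $\int_E p_t(x,y)\,\mathfrak m(dy)\le 1$. Classes of measures. - For $\delta\in]0,1]$, $S_K^{\,p,\delta}$ is the set of positive Radon measures $\mu$ on $E$ with $\sup_{x\in E}\Big(\int_E\big(\int_0^tp_s(x,y)\,ds\big)^p\mu(dy)\Big)^{1/p}=O(t^\delta)$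 as $t\to0$. - $S_D$ is the set of positive Radon measures $\mu$ on $E$ with $\sup_{x\in E}\int_E\int_0^tp_s(x,y)\,ds\,\mu(dy)<+\infty$ for some $t>0$. *)

theory Defs
  imports "HOL-Probability.Probability"
begin

section \<open>Radon measures\<close>

text \<open>On a locally compact separable metric space every Borel measure that is finite on compact
  sets is automatically inner and outer regular.\<close>

definition radon_measure :: "'a::topological_space measure \<Rightarrow> bool" where
  "radon_measure M \<longleftrightarrow> sets M = sets borel \<and> (\<forall>K. compact K \<longrightarrow> emeasure M K < \<infinity>)"

definition full_support :: "'a::topological_space measure \<Rightarrow> bool" where
  "full_support M \<longleftrightarrow> (\<forall>U. open U \<and> U \<noteq> {} \<longrightarrow> 0 < emeasure M U)"

section \<open>Symmetric regular Dirichlet forms\<close>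

text \<open>Elements of \<open>L\<^sup>2(E;m)\<close> are represented by functions; the form domain below is therefore
  required to be saturated, and the form to be invariant, under almost everywhere equality.\<close>

definition L2 :: "'a measure \<Rightarrow> ('a \<Rightarrow> real) set" where
  "L2 m = {u \<in> borel_measurable m. integrable m (\<lambda>x. (u x)\<^sup>2)}"

definition l2_inner :: "'a measure \<Rightarrow> ('a \<Rightarrow> real) \<Rightarrow> ('a \<Rightarrow> real) \<Rightarrow> real" where
  "l2_inner m u v = (\<integral>x. u x * v x \<partial>m)"

definition l2_norm :: "'a measure \<Rightarrow> ('a \<Rightarrow> real) \<Rightarrow> real" where
  "l2_norm m u = sqrt (l2_inner m u u)"

definition form_plus ::
  "'a measure \<Rightarrow> (('a \<Rightarrow> real) \<Rightarrow> ('a \<Rightarrow> real) \<Rightarrow> real) \<Rightarrow> real \<Rightarrow>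
   ('a \<Rightarrow> real) \<Rightarrow> ('a \<Rightarrow> real) \<Rightarrow> real" where
  "form_plus m \<E> \<alpha> u v = \<E> u v + \<alpha> * l2_inner m u v"

definition symmetric_form ::
  "'a measure \<Rightarrow> ('a \<Rightarrow> real) set \<Rightarrow> (('a \<Rightarrow> real) \<Rightarrow> ('a \<Rightarrow> real) \<Rightarrow> real) \<Rightarrow> bool" where
  "symmetric_form m \<F> \<E> \<longleftrightarrow>
     \<F> \<subseteq> L2 m \<and>
     (\<forall>u\<in>\<F>. \<forall>v\<in>\<F>. \<forall>a b. (\<lambda>x. a * u x + b * v x) \<in> \<F>) \<and>
     (\<forall>u\<in>\<F>. \<forall>v\<in>borel_measurable m. (AE x in m. u x = v x) \<longrightarrow> v \<in> \<F>) \<and>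
     (\<forall>u\<in>L2 m. \<forall>e>0. \<exists>v\<in>\<F>. l2_norm m (\<lambda>x. u x - v x) < e) \<and>
     (\<forall>u\<in>\<F>. \<forall>u'\<in>\<F>. (AE x in m. u x = u' x) \<longrightarrow> (\<forall>v\<in>\<F>. \<E> u v = \<E> u' v)) \<and>
     (\<forall>u\<in>\<F>. \<forall>v\<in>\<F>. \<E> u v = \<E> v u) \<and>
     (\<forall>u\<in>\<F>. \<forall>v\<in>\<F>. \<forall>w\<in>\<F>. \<forall>a b. \<E> (\<lambda>x. a * u x + b * v x) w = a * \<E> u w + b * \<E> v w) \<and>
     (\<forall>u\<in>\<F>. 0 \<le> \<E> u u)"

definition closed_form ::
  "'a measure \<Rightarrow> ('a \<Rightarrow> real) set \<Rightarrow> (('a \<Rightarrow> real) \<Rightarrow> ('a \<Rightarrow> real) \<Rightarrow> real) \<Rightarrow> bool" where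
  "closed_form m \<F> \<E> \<longleftrightarrow>
     (\<forall>f :: nat \<Rightarrow> 'a \<Rightarrow> real.
        (\<forall>n. f n \<in> \<F>) \<longrightarrow>
        (\<forall>e>0. \<exists>N. \<forall>i\<ge>N. \<forall>j\<ge>N.
           form_plus m \<E> 1 (\<lambda>x. f i x - f j x) (\<lambda>x. f i x - f j x) < e) \<longrightarrow>
        (\<exists>u\<in>\<F>. (\<lambda>n. form_plus m \<E> 1 (\<lambda>x. f n x - u x) (\<lambda>x. f n x - u x)) \<longlonglongrightarrow> 0))"

definition markovian_form ::
  "('a \<Rightarrow> real) set \<Rightarrow> (('a \<Rightarrow> real) \<Rightarrow> ('a \<Rightarrow> real) \<Rightarrow> real) \<Rightarrow> bool" where
  "markovian_form \<F> \<E> \<longleftrightarrow>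
     (\<forall>u\<in>\<F>. (\<lambda>x. min (max (u x) 0) 1) \<in> \<F> \<and>
        \<E> (\<lambda>x. min (max (u x) 0) 1) (\<lambda>x. min (max (u x) 0) 1) \<le> \<E> u u)"

definition symmetric_dirichlet_form ::
  "'a measure \<Rightarrow> ('a \<Rightarrow> real) set \<Rightarrow> (('a \<Rightarrow> real) \<Rightarrow> ('a \<Rightarrow> real) \<Rightarrow> real) \<Rightarrow> bool" where
  "symmetric_dirichlet_form m \<F> \<E> \<longleftrightarrow>
     symmetric_form m \<F> \<E> \<and> closed_form m \<F> \<E> \<and> markovian_form \<F> \<E>"

definition compactly_supported_continuous :: "('a::topological_space \<Rightarrow> real) set" where
  "compactly_supported_continuous =
     {u. continuous_on UNIV u \<and> compact (closure {x. u x \<noteq> 0})}"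

definition regular_form ::
  "'a::topological_space measure \<Rightarrow> ('a \<Rightarrow> real) set \<Rightarrow>
   (('a \<Rightarrow> real) \<Rightarrow> ('a \<Rightarrow> real) \<Rightarrow> real) \<Rightarrow> bool" where
  "regular_form m \<F> \<E> \<longleftrightarrow>
     (\<forall>u\<in>\<F>. \<forall>e>0. \<exists>v\<in>\<F> \<inter> compactly_supported_continuous.
        form_plus m \<E> 1 (\<lambda>x. u x - v x) (\<lambda>x. u x - v x) < e) \<and>
     (\<forall>u\<in>compactly_supported_continuous. \<forall>e>0. \<exists>v\<in>\<F> \<inter> compactly_supported_continuous.
        \<forall>x. \<bar>u x - v x\<bar> < e)"

text \<open>Strongly continuous semigroup of symmetric contractions on \<open>L\<^sup>2(E;m)\<close>.\<close>

definition l2_semigroup ::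
  "'a measure \<Rightarrow> (real \<Rightarrow> ('a \<Rightarrow> real) \<Rightarrow> 'a \<Rightarrow> real) \<Rightarrow> bool" where
  "l2_semigroup m T \<longleftrightarrow>
     (\<forall>t>0. \<forall>u\<in>L2 m. T t u \<in> L2 m) \<and>
     (\<forall>t>0. \<forall>u\<in>L2 m. \<forall>v\<in>L2 m. (AE x in m. u x = v x) \<longrightarrow> (AE x in m. T t u x = T t v x)) \<and>
     (\<forall>t>0. \<forall>u\<in>L2 m. \<forall>v\<in>L2 m. \<forall>a b.
        AE x in m. T t (\<lambda>y. a * u y + b * v y) x = a * T t u x + b * T t v x) \<and>
     (\<forall>t>0. \<forall>u\<in>L2 m. \<forall>v\<in>L2 m. l2_inner m (T t u) v = l2_inner m u (T t v)) \<and>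
     (\<forall>t>0. \<forall>u\<in>L2 m. l2_norm m (T t u) \<le> l2_norm m u) \<and>
     (\<forall>s>0. \<forall>t>0. \<forall>u\<in>L2 m. AE x in m. T (s + t) u x = T s (T t u) x) \<and>
     (\<forall>u\<in>L2 m. ((\<lambda>t. l2_norm m (\<lambda>x. T t u x - u x)) \<longlongrightarrow> 0) (at_right 0))"

text \<open>The semigroup of a closed form is the one whose resolvent
  \<open>G\<^sub>\<alpha> u = \<integral>\<^sub>0\<^sup>\<infinity> e\<^sup>-\<^sup>\<alpha>\<^sup>t T\<^sub>t u dt\<close> (here called \<open>w\<close>, the integral being taken weakly) is characterized by
  \<open>G\<^sub>\<alpha> u \<in> \<F>\<close> and \<open>\<E>\<^sub>\<alpha>(G\<^sub>\<alpha> u, v) = (u, v)\<close> for all \<open>v \<in> \<F>\<close>.\<close>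

definition semigroup_of_form ::
  "'a measure \<Rightarrow> ('a \<Rightarrow> real) set \<Rightarrow> (('a \<Rightarrow> real) \<Rightarrow> ('a \<Rightarrow> real) \<Rightarrow> real) \<Rightarrow>
   (real \<Rightarrow> ('a \<Rightarrow> real) \<Rightarrow> 'a \<Rightarrow> real) \<Rightarrow> bool" where
  "semigroup_of_form m \<F> \<E> T \<longleftrightarrow>
     l2_semigroup m T \<and>
     (\<forall>\<alpha>>0. \<forall>u\<in>L2 m. \<exists>w\<in>\<F>.
        (\<forall>v\<in>L2 m. (LINT t:{0<..}|lborel. exp (- \<alpha> * t) * l2_inner m (T t u) v) = l2_inner m w v) \<and>
        (\<forall>v\<in>\<F>. form_plus m \<E> \<alpha> w v = l2_inner m u v))"

section \<open>Hunt processes\<close>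

text \<open>\<open>E\<^sub>\<partial>\<close> is the type \<open>'a option\<close>, with \<open>None\<close> as cemetery \<open>\<partial>\<close>, carrying the topology of the
  one-point compactification (\<open>\<partial>\<close> is isolated if \<open>E\<close> is compact).\<close>

abbreviation cemetery_topology :: "'a::topological_space option topology" where
  "cemetery_topology \<equiv> Alexandroff_compactification euclidean"

definition borel_cemetery :: "'a::topological_space option measure" where
  "borel_cemetery = sigma UNIV {U. openin cemetery_topology U}"

text \<open>Time runs through \<open>[0,\<infinity>]\<close>, modelled by \<^typ>\<open>ennreal\<close>; so \<open>X (\<sigma> \<omega>) \<omega>\<close> makes sense on
  \<open>{\<sigma> = \<infinity>}\<close>. A filtration is admissible if it is right-continuous and the process is adapted.\<close>

definition admissible_filtration ::
  "'w measure \<Rightarrow> (ennreal \<Rightarrow> 'w \<Rightarrow> 'a::topological_space option) \<Rightarrow>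
   (ennreal \<Rightarrow> 'w measure) \<Rightarrow> bool" where
  "admissible_filtration N X F \<longleftrightarrow>
     filtration (space N) F \<and>
     (\<forall>t. sets (F t) \<subseteq> sets N) \<and>
     sets (F \<infinity>) = sigma_sets (space N) (\<Union>t\<in>{t. t < \<infinity>}. sets (F t)) \<and>
     (\<forall>t<\<infinity>. X t \<in> measurable (F t) borel_cemetery) \<and>
     (\<forall>t<\<infinity>. sets (F t) = (\<Inter>s\<in>{t<..}. sets (F s)))"

text \<open>Taking constant \<open>\<sigma>\<close> gives the simple Markov property. It suffices to start the process at points
  \<open>z \<in> E\<^sub>\<partial>\<close>: integration over \<open>z\<close> gives the property for all initial laws. The same applies to
  quasi-left-continuity.\<close>

definition strong_markov ::
  "'w measure \<Rightarrow> (ennreal \<Rightarrow> 'w \<Rightarrow> 'a::topological_space option) \<Rightarrow>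
   ('a option \<Rightarrow> 'w measure) \<Rightarrow> (ennreal \<Rightarrow> 'w measure) \<Rightarrow> bool" where
  "strong_markov N X P F \<longleftrightarrow>
     (\<forall>\<sigma>. stopping_time F \<sigma> \<longrightarrow>
        (\<forall>z s. \<forall>B\<in>sets borel_cemetery.
           AE \<omega> in P z.
             real_cond_exp (P z) (filtration.pre_sigma (space N) F \<sigma>)
               (indicator {\<omega>'\<in>space N. X (\<sigma> \<omega>' + s) \<omega>' \<in> B}) \<omega>
             = measure (P (X (\<sigma> \<omega>) \<omega>)) {\<omega>'\<in>space N. X s \<omega>' \<in> B}))"

definition quasi_left_continuous ::
  "(ennreal \<Rightarrow> 'w \<Rightarrow> 'a::topological_space option) \<Rightarrow>
   ('a option \<Rightarrow> 'w measure) \<Rightarrow> (ennreal \<Rightarrow> 'w measure) \<Rightarrow> bool" where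
  "quasi_left_continuous X P F \<longleftrightarrow>
     (\<forall>\<sigma> :: nat \<Rightarrow> 'w \<Rightarrow> ennreal.
        (\<forall>n. stopping_time F (\<sigma> n)) \<and> (\<forall>\<omega>. incseq (\<lambda>n. \<sigma> n \<omega>)) \<longrightarrow>
        (\<forall>z. AE \<omega> in P z. (SUP n. \<sigma> n \<omega>) < \<infinity> \<longrightarrow>
           limitin cemetery_topology (\<lambda>n. X (\<sigma> n \<omega>) \<omega>) (X (SUP n. \<sigma> n \<omega>) \<omega>) sequentially))"

text \<open>Only the space and the \<open>\<sigma>\<close>-algebra of \<open>N\<close> matter: it is the measurable space underlying all the
  laws \<open>P z\<close>.\<close>

definition hunt_process ::
  "'w measure \<Rightarrow> (ennreal \<Rightarrow> 'w \<Rightarrow> 'a::topological_space option) \<Rightarrow> ('w \<Rightarrow> ennreal) \<Rightarrow>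
   ('a option \<Rightarrow> 'w measure) \<Rightarrow> bool" where
  "hunt_process N X \<zeta> P \<longleftrightarrow>
     (\<forall>z. prob_space (P z) \<and> sets (P z) = sets N) \<and>
     (\<forall>t. X t \<in> measurable N borel_cemetery) \<and>
     (\<forall>t. \<forall>B\<in>sets borel.
        (\<lambda>x. measure (P (Some x)) {\<omega>\<in>space N. X t \<omega> \<in> Some ` B}) \<in> borel_measurable borel) \<and>
     (\<forall>t. AE \<omega> in P None. X t \<omega> = None) \<and>
     (\<forall>x. AE \<omega> in P (Some x). X 0 \<omega> = Some x) \<and>
     (\<forall>\<omega>\<in>space N. X \<infinity> \<omega> = None) \<and>
     (\<forall>\<omega>\<in>space N. \<zeta> \<omega> = Inf {t. X t \<omega> = None}) \<and>
     (\<forall>\<omega>\<in>space N. \<forall>t\<ge>\<zeta> \<omega>. X t \<omega> = None) \<and>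
     (\<forall>t. \<exists>\<theta>. \<theta> ` space N \<subseteq> space N \<and> (\<forall>\<omega>\<in>space N. \<forall>s. X s (\<theta> \<omega>) = X (s + t) \<omega>)) \<and>
     (\<forall>\<omega>\<in>space N. \<forall>t<\<infinity>.
        limitin cemetery_topology (\<lambda>s. X s \<omega>) (X t \<omega>) (at_right t)) \<and>
     (\<forall>\<omega>\<in>space N. \<forall>t. 0 < t \<and> t < \<infinity> \<longrightarrow>
        (\<exists>l. limitin cemetery_topology (\<lambda>s. X s \<omega>) l (at_left t))) \<and>
     (\<exists>F. admissible_filtration N X F \<and> strong_markov N X P F \<and> quasi_left_continuous X P F)"

text \<open>\<open>E\<^sub>x[u(X\<^sub>t)]\<close>, with the convention \<open>u(\<partial>) = 0\<close>.\<close>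

definition transition ::
  "(ennreal \<Rightarrow> 'w \<Rightarrow> 'a option) \<Rightarrow> ('a option \<Rightarrow> 'w measure) \<Rightarrow>
   real \<Rightarrow> ('a \<Rightarrow> real) \<Rightarrow> 'a \<Rightarrow> real" where
  "transition X P t u x = (\<integral>\<omega>. case_option 0 u (X (ennreal t) \<omega>) \<partial>P (Some x))"

definition associated_process ::
  "'a::topological_space measure \<Rightarrow> ('a \<Rightarrow> real) set \<Rightarrow>
   (('a \<Rightarrow> real) \<Rightarrow> ('a \<Rightarrow> real) \<Rightarrow> real) \<Rightarrow>
   (ennreal \<Rightarrow> 'w \<Rightarrow> 'a option) \<Rightarrow> ('a option \<Rightarrow> 'w measure) \<Rightarrow> bool" where
  "associated_process m \<F> \<E> X P \<longleftrightarrow>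
     (\<exists>T. semigroup_of_form m \<F> \<E> T \<and>
        (\<forall>t>0. \<forall>u\<in>L2 m. u \<in> borel_measurable borel \<and> bounded (range u) \<longrightarrow>
           (AE x in m. transition X P t u x = T t u x)))"

section \<open>Semigroup kernels\<close>

definition semigroup_kernel ::
  "'a::topological_space measure \<Rightarrow> (ennreal \<Rightarrow> 'w \<Rightarrow> 'a option) \<Rightarrow>
   ('a option \<Rightarrow> 'w measure) \<Rightarrow> (real \<Rightarrow> 'a \<Rightarrow> 'a \<Rightarrow> real) \<Rightarrow> bool" where
  "semigroup_kernel m X P h \<longleftrightarrow>
     (\<lambda>(t, x, y). h t x y) \<in>
       borel_measurable (restrict_space borel {0<..} \<Otimes>\<^sub>M (borel \<Otimes>\<^sub>M borel)) \<and>
     (\<forall>t>0. \<forall>x y. 0 \<le> h t x y) \<and>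
     (\<forall>t>0. \<forall>x. \<forall>u\<in>borel_measurable borel. bounded (range u) \<longrightarrow>
        transition X P t u x = (\<integral>y. h t x y * u y \<partial>m)) \<and>
     (\<forall>t>0. \<forall>s>0. \<forall>x y.
        ennreal (h (t + s) x y) = (\<integral>\<^sup>+z. ennreal (h s x z) * ennreal (h t z y) \<partial>m)) \<and>
     (\<forall>t>0. \<forall>x. (\<integral>\<^sup>+y. ennreal (h t x y) \<partial>m) \<le> 1)"

section \<open>Classes of measures\<close>

definition integrated_kernel :: "(real \<Rightarrow> 'a \<Rightarrow> 'a \<Rightarrow> real) \<Rightarrow> real \<Rightarrow> 'a \<Rightarrow> 'a \<Rightarrow> ennreal" where
  "integrated_kernel h t x y = (\<integral>\<^sup>+s\<in>{0<..<t}. ennreal (h s x y) \<partial>lborel)"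

text \<open>Only meant for exponents \<open>a > 0\<close>.\<close>

definition ennreal_powr :: "ennreal \<Rightarrow> real \<Rightarrow> ennreal" where
  "ennreal_powr x a = (if x = \<infinity> then \<infinity> else ennreal (enn2real x powr a))"

text \<open>The quantity that has to be \<open>O(t\<^sup>\<delta>)\<close> may be infinite for large \<open>t\<close>, so the \<open>O\<close> is written out in
  \<^typ>\<open>ennreal\<close>.\<close>

definition S_K ::
  "(real \<Rightarrow> 'a \<Rightarrow> 'a \<Rightarrow> real) \<Rightarrow> real \<Rightarrow> real \<Rightarrow> 'a::topological_space measure set" where
  "S_K h p \<delta> = {\<mu>. radon_measure \<mu> \<and>
     (\<exists>K::real. \<forall>\<^sub>F t in at_right 0.
        (SUP x. ennreal_powr (\<integral>\<^sup>+y. ennreal_powr (integrated_kernel h t x y) p \<partial>\<mu>) (1 / p))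
          \<le> ennreal (K * t powr \<delta>))}"

definition S_D :: "(real \<Rightarrow> 'a \<Rightarrow> 'a \<Rightarrow> real) \<Rightarrow> 'a::topological_space measure set" where
  "S_D h = {\<mu>. radon_measure \<mu> \<and>
     (\<exists>t>0. (SUP x. \<integral>\<^sup>+y. integrated_kernel h t x y \<partial>\<mu>) < \<infinity>)}"

text \<open>\<open>a / b\<^sub>+\<close>, with value \<open>\<infinity>\<close> for \<open>b \<le> 0\<close>.\<close>

definition div_pos_part :: "real \<Rightarrow> real \<Rightarrow> ereal" where
  "div_pos_part a b = (if b > 0 then ereal (a / b) else \<infinity>)"

end

theory Submission
  imports Defs
begin

text \<open>Write \<open>G\<close> for the kernel integrated over the times up to \<open>t\<close> and \<open>d\<close> for the distance of the
  two points. If \<open>u powr b * \<Phi> u\<close> is bounded by \<open>M\<close>, then the kernel at time \<open>s\<close> is at most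
  \<open>M * s powr ((b - \<nu>) / \<beta>) * d powr - b\<close>, and integration in time gives
  \<open>G \<le> M / e * t powr e * d powr - b\<close> with \<open>e = 1 + (b - \<nu>) / \<beta>\<close>, provided \<open>e > 0\<close>
  (\<open>integrated_kernel_le\<close>). Since \<open>\<Phi>\<close> is decreasing, its moment condition makes every \<open>b\<close> from \<open>0\<close>
  to \<open>\<nu>\<close> admissible (\<open>antimono_integrable_imp_powr_bound\<close>). The theorem follows from suitable
  choices of \<open>b\<close> near and far from the diagonal.

  Near the diagonal, the \<open>p\<close>-th power of this bound is \<open>\<mu>\<close>-integrable, uniformly in the pole, as soon
  as \<open>p * b < \<eta>\<close>, by the growth of balls. This inequality says precisely that
  \<open>e < (\<eta> - p * (\<nu> - \<beta>)) / (p * \<beta>)\<close>: the critical exponent of the theorem is the one of the near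
  part, and it is at most \<open>1\<close>.

  Far from the diagonal, \<open>b = \<nu>\<close> gives \<open>G\<close> of order \<open>t\<close>. If \<open>\<mu>\<close> is finite, or if balls of every radius
  satisfy the growth condition and \<open>p > 1\<close> (so that \<open>p * \<nu> > \<eta>\<close>), the norm of the far part is
  therefore of order \<open>t\<close>, which is enough. If \<open>\<mu>\<close> is only known to belong to \<open>S_D\<close>, one of the \<open>p\<close>
  factors is spent on integrability (\<open>kernel_power_order_far_if_S_D\<close>), and the norm is of order
  \<open>t powr ((p - 1) / p)\<close>. This is at least as good as the near part if and only if
  \<open>(\<eta> + \<beta>) / \<nu> \<le> p\<close>; for smaller \<open>p\<close> the critical exponent multiplied by \<open>(p - 1) / p\<close> bounds both
  orders from below. If all moments of \<open>\<Phi>\<close> are finite, a larger \<open>b = \<nu> + \<gamma>\<close> compensates for the lost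
  factor.\<close>

section \<open>Powers of extended nonnegative reals\<close>

lemma ennreal_powr_ennreal [simp]: "0 \<le> a \<Longrightarrow> ennreal_powr (ennreal a) q = ennreal (a powr q)"
  by (simp add: ennreal_powr_def)

lemma ennreal_powr_mono: "x \<le> y \<Longrightarrow> 0 \<le> q \<Longrightarrow> ennreal_powr x q \<le> ennreal_powr y q"
  by (cases x; cases y) (auto simp: ennreal_powr_def top_unique intro!: ennreal_leI powr_mono2)

lemma borel_measurable_ennreal_powr [measurable]:
  assumes [measurable]: "f \<in> borel_measurable M"
  shows "(\<lambda>x. ennreal_powr (f x) q) \<in> borel_measurable M"
  unfolding ennreal_powr_def by measurable

lemma ennreal_powr_le_linear:
  assumes "x \<le> ennreal c" and "0 \<le> c" and "1 \<le> q"
  shows "ennreal_powr x q \<le> ennreal (c powr (q - 1)) * x"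
proof -
  obtain a where a: "x = ennreal a" "0 \<le> a"
    using assms(1) by (cases x) (auto simp: top_unique)
  have "a powr q = a powr (q - 1) * a"
    using a(2) by (cases "a = 0") (auto simp: powr_diff)
  also have "\<dots> \<le> c powr (q - 1) * a"
    using a assms by (intro mult_right_mono powr_mono2) auto
  finally show ?thesis
    using a by (simp add: ennreal_mult[symmetric] ennreal_leI)
qed

section \<open>Power functions of the distance under a ball growth condition\<close>

lemma emeasure_singleton_eq_0_if_ball_growth:
  fixes \<mu> :: "'a::metric_space measure"
  assumes sets: "sets \<mu> = sets borel" and "0 < r0" "0 < \<eta>"
    and growth: "\<And>r. 0 < r \<Longrightarrow> r < r0 \<Longrightarrow> emeasure \<mu> (ball x r) \<le> ennreal (C * r powr \<eta>)"
  shows "emeasure \<mu> {x} = 0"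
proof -
  have "((\<lambda>r. C * r powr \<eta>) \<longlongrightarrow> C * 0) (at_right 0)"
    using \<open>0 < \<eta>\<close>
    by (intro tendsto_intros tendsto_zero_powrI[where b = \<eta>]) (auto simp: eventually_at_filter)
  then have "((\<lambda>r. ennreal (C * r powr \<eta>)) \<longlongrightarrow> ennreal 0) (at_right 0)"
    by (intro tendsto_ennrealI) simp
  moreover have "eventually (\<lambda>r. emeasure \<mu> {x} \<le> ennreal (C * r powr \<eta>)) (at_right 0)"
    using eventually_at_right_real[OF \<open>0 < r0\<close>]
  proof eventually_elim
    case (elim r)
    have "emeasure \<mu> {x} \<le> emeasure \<mu> (ball x r)"
      using elim by (intro emeasure_mono) (auto simp: sets)
    also have "\<dots> \<le> ennreal (C * r powr \<eta>)"
      using elim by (intro growth) auto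
    finally show ?case .
  qed
  ultimately have "emeasure \<mu> {x} \<le> ennreal 0"
    by (intro tendsto_le[OF _ _ tendsto_const]) auto
  then show ?thesis by simp
qed

text \<open>On an annulus of inner radius \<open>\<rho>\<close> and outer radius \<open>2 \<rho>\<close> the integrand is at most \<open>\<rho>\<close> to the
  power \<open>- a\<close>, and the annulus has mass at most of order \<open>\<rho>\<close> to the power \<open>\<eta>\<close>. Along radii in geometric
  progression of ratio \<open>q\<close> the contributions form a geometric series of ratio \<open>q\<close> to the power
  \<open>\<eta> - a\<close>: shrinking annuli (\<open>q = 1 / 2\<close>) can be summed if \<open>a < \<eta>\<close>, growing ones (\<open>q = 2\<close>)
  if \<open>a > \<eta>\<close>.\<close>

lemma nn_integral_dist_powr_annuli:
  fixes \<mu> :: "'a::metric_space measure"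
  assumes sets: "sets \<mu> = sets borel" and pos: "0 < R" "0 < q" "0 \<le> C" "0 \<le> a"
    and cover: "\<And>y. y \<in> S \<Longrightarrow> y \<noteq> x \<Longrightarrow> \<exists>k. R * q ^ k \<le> dist x y \<and> dist x y < 2 * (R * q ^ k)"
    and growth: "\<And>k::nat. emeasure \<mu> (ball x (2 * (R * q ^ k))) \<le> ennreal (C * (2 * (R * q ^ k)) powr \<eta>)"
    and ratio: "q powr (\<eta> - a) < 1"
  shows "(\<integral>\<^sup>+y\<in>S. ennreal (dist x y powr - a) \<partial>\<mu>)
    \<le> ennreal (C * 2 powr \<eta> * R powr (\<eta> - a) / (1 - q powr (\<eta> - a)))"
proof -
  let ?\<rho> = "\<lambda>k::nat. R * q ^ k"
  have \<rho>: "0 < ?\<rho> k" for k using pos by simp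
  have [measurable]: "ball x r \<in> sets \<mu>" for r by (simp add: sets)
  have "(\<integral>\<^sup>+y\<in>S. ennreal (dist x y powr - a) \<partial>\<mu>)
      \<le> (\<integral>\<^sup>+y. (\<Sum>k. ennreal (?\<rho> k powr - a) * indicator (ball x (2 * ?\<rho> k)) y) \<partial>\<mu>)"
  proof (intro nn_integral_mono)
    fix y
    define f where "f k = ennreal (?\<rho> k powr - a) * indicator (ball x (2 * ?\<rho> k)) y" for k
    have "ennreal (dist x y powr - a) * indicator S y \<le> (\<Sum>k. f k)"
    proof (cases "y \<in> S \<and> y \<noteq> x")
      case True
      then obtain k where k: "?\<rho> k \<le> dist x y" "dist x y < 2 * ?\<rho> k" using cover by blast
      have "ennreal (dist x y powr - a) * indicator S y \<le> f k"
        using True k \<rho>[of k] pos by (auto simp: f_def intro!: ennreal_leI powr_mono2')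
      also have "\<dots> \<le> (\<Sum>k. f k)"
        using sum_le_suminf[of f "{k}"] by simp
      finally show ?thesis .
    qed (auto simp: indicator_def)
    then show "ennreal (dist x y powr - a) * indicator S y
        \<le> (\<Sum>k. ennreal (?\<rho> k powr - a) * indicator (ball x (2 * ?\<rho> k)) y)"
      by (simp only: f_def)
  qed
  also have "\<dots> = (\<Sum>k. ennreal (?\<rho> k powr - a) * emeasure \<mu> (ball x (2 * ?\<rho> k)))"
    by (subst nn_integral_suminf) (auto simp: nn_integral_cmult_indicator)
  also have "\<dots> \<le> (\<Sum>k. ennreal (C * 2 powr \<eta> * R powr (\<eta> - a) * (q powr (\<eta> - a)) ^ k))"
  proof (intro suminf_le)
    fix k
    have "ennreal (?\<rho> k powr - a) * emeasure \<mu> (ball x (2 * ?\<rho> k))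
        \<le> ennreal (?\<rho> k powr - a) * ennreal (C * (2 * ?\<rho> k) powr \<eta>)"
      by (intro mult_left_mono growth) simp
    also have "\<dots> = ennreal (?\<rho> k powr - a * (C * (2 * ?\<rho> k) powr \<eta>))"
      using pos by (simp add: ennreal_mult)
    also have "(2 * ?\<rho> k) powr \<eta> = 2 powr \<eta> * ?\<rho> k powr \<eta>"
      using \<rho>[of k] by (simp add: powr_mult)
    also have "?\<rho> k powr - a * (C * (2 powr \<eta> * ?\<rho> k powr \<eta>)) = C * 2 powr \<eta> * ?\<rho> k powr (\<eta> - a)"
      by (simp add: powr_diff powr_minus field_simps)
    also have "?\<rho> k powr (\<eta> - a) = R powr (\<eta> - a) * (q powr (\<eta> - a)) ^ k"
      using pos by (simp add: powr_mult powr_realpow[symmetric] powr_powr mult.commute)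
    finally show "ennreal (?\<rho> k powr - a) * emeasure \<mu> (ball x (2 * ?\<rho> k))
        \<le> ennreal (C * 2 powr \<eta> * R powr (\<eta> - a) * (q powr (\<eta> - a)) ^ k)"
      by (simp add: mult.assoc)
  qed auto
  also have "\<dots> = ennreal (C * 2 powr \<eta> * R powr (\<eta> - a) * (1 / (1 - q powr (\<eta> - a))))"
    using pos ratio by (intro suminf_ennreal_eq sums_mult geometric_sums) auto
  finally show ?thesis by simp
qed

lemma nn_integral_dist_powr_ball:
  fixes \<mu> :: "'a::metric_space measure"
  assumes "sets \<mu> = sets borel" and "0 < R" "R < r0" "0 \<le> C" "0 \<le> a" "a < \<eta>"
    and growth: "\<And>x r. 0 < r \<Longrightarrow> r < r0 \<Longrightarrow> emeasure \<mu> (ball x r) \<le> ennreal (C * r powr \<eta>)"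
  shows "\<exists>L. \<forall>x. (\<integral>\<^sup>+y\<in>ball x R. ennreal (dist x y powr - a) \<partial>\<mu>) \<le> ennreal L"
proof (rule exI, rule allI, rule nn_integral_dist_powr_annuli[where R = "R / 2" and q = "1 / 2" and C = C and \<eta> = \<eta>])
  fix x y assume y: "y \<in> ball x R" "y \<noteq> x"
  then have "\<exists>k. (1 / 2) ^ k < dist x y / R"
    using \<open>0 < R\<close> by (intro real_arch_pow_inv) auto
  then have ex: "\<exists>k. R * (1 / 2) ^ k \<le> dist x y"
    using \<open>0 < R\<close> by (auto simp: field_simps intro: less_imp_le)
  define n where "n = (LEAST k. R * (1 / 2) ^ k \<le> dist x y)"
  have n: "R * (1 / 2) ^ n \<le> dist x y"
    unfolding n_def using ex by (rule LeastI_ex)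
  then obtain k where k: "n = Suc k"
    using y by (cases n) auto
  have "k < n" using k by simp
  then have "\<not> R * (1 / 2) ^ k \<le> dist x y"
    unfolding n_def by (rule not_less_Least)
  then show "\<exists>k. R / 2 * (1 / 2) ^ k \<le> dist x y \<and> dist x y < 2 * (R / 2 * (1 / 2) ^ k)"
    using n k by (intro exI[of _ k]) auto
next
  fix x and k :: nat
  have "R * (1 / 2) ^ k \<le> R * 1"
    using \<open>0 < R\<close> by (intro mult_left_mono power_le_one) auto
  then have "R * (1 / 2) ^ k < r0" using \<open>R < r0\<close> by linarith
  then show "emeasure \<mu> (ball x (2 * (R / 2 * (1 / 2) ^ k)))
      \<le> ennreal (C * (2 * (R / 2 * (1 / 2) ^ k)) powr \<eta>)"
    using assms by (intro growth) auto
next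
  show "(1 / 2) powr (\<eta> - a) < (1::real)"
    using \<open>a < \<eta>\<close> powr_less_mono2[of "\<eta> - a" "1 / 2" 1] by simp
qed (use assms in auto)

lemma nn_integral_dist_powr_outside_ball:
  fixes \<mu> :: "'a::metric_space measure"
  assumes "sets \<mu> = sets borel" and "0 < R" "0 \<le> C" "0 \<le> a" "\<eta> < a"
    and growth: "\<And>x r. 0 < r \<Longrightarrow> emeasure \<mu> (ball x r) \<le> ennreal (C * r powr \<eta>)"
  shows "\<exists>L. \<forall>x. (\<integral>\<^sup>+y\<in>- ball x R. ennreal (dist x y powr - a) \<partial>\<mu>) \<le> ennreal L"
proof (rule exI, rule allI, rule nn_integral_dist_powr_annuli[where R = R and q = 2 and C = C and \<eta> = \<eta>])
  fix x y assume y: "y \<in> - ball x R" "y \<noteq> x"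
  have "\<exists>k. dist x y / R < 2 ^ k"
    by (intro real_arch_pow) auto
  then have ex: "\<exists>k. dist x y < R * 2 ^ k"
    using \<open>0 < R\<close> by (auto simp: field_simps)
  define n where "n = (LEAST k. dist x y < R * 2 ^ k)"
  have n: "dist x y < R * 2 ^ n"
    unfolding n_def using ex by (rule LeastI_ex)
  then obtain k where k: "n = Suc k"
    using y by (cases n) auto
  have "k < n" using k by simp
  then have "\<not> dist x y < R * 2 ^ k"
    unfolding n_def by (rule not_less_Least)
  then show "\<exists>k. R * 2 ^ k \<le> dist x y \<and> dist x y < 2 * (R * 2 ^ k)"
    using n k by (intro exI[of _ k]) auto
next
  show "2 powr (\<eta> - a) < (1::real)"
    using \<open>\<eta> < a\<close> powr_less_mono[of "\<eta> - a" 0 2] by simp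
qed (use assms in auto)

section \<open>Decay of a decreasing profile\<close>

text \<open>By monotonicity, \<open>\<Phi> u\<close> is at most the average of \<open>\<Phi>\<close> over the interval from \<open>u / 2\<close> to \<open>u\<close>,
  on which the weight is comparable to its value at \<open>u\<close>; so the integral bounds the weighted value
  at \<open>u\<close> itself.\<close>

lemma antimono_integrable_imp_powr_bound:
  fixes \<Phi> :: "real \<Rightarrow> real"
  assumes nonneg: "\<And>u. 0 \<le> u \<Longrightarrow> 0 \<le> \<Phi> u" and anti: "antimono_on {0..} \<Phi>" and "0 < b"
    and fin: "(\<integral>\<^sup>+u\<in>{1..}. ennreal (u powr (b - 1) * \<Phi> u) \<partial>lborel) < \<infinity>"
  shows "\<exists>M\<ge>0. \<forall>u\<ge>0. u powr b * \<Phi> u \<le> M"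
proof -
  obtain I where I: "0 \<le> I" "(\<integral>\<^sup>+u\<in>{1..}. ennreal (u powr (b - 1) * \<Phi> u) \<partial>lborel) = ennreal I"
    using fin by (cases "\<integral>\<^sup>+u\<in>{1..}. ennreal (u powr (b - 1) * \<Phi> u) \<partial>lborel") auto
  have "u powr b * \<Phi> u \<le> max (2 powr b * \<Phi> 0) (2 powr (b + 1) * I)" if "0 \<le> u" for u
  proof (cases "u < 2")
    case True
    then have "u powr b * \<Phi> u \<le> 2 powr b * \<Phi> 0"
      using that \<open>0 < b\<close> nonneg monotone_onD[OF anti, of 0 u]
      by (intro mult_mono powr_mono2) auto
    then show ?thesis by simp
  next
    case False
    let ?c = "(u / 2) powr b / u * \<Phi> u"
    have c: "0 \<le> ?c" using that nonneg by simp
    have "ennreal (?c * (u / 2)) = (\<integral>\<^sup>+v. ennreal ?c * indicator {u / 2..u} v \<partial>lborel)"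
      using False c ennreal_mult[of ?c "u / 2"] by (subst nn_integral_cmult_indicator) simp_all
    also have "\<dots> \<le> (\<integral>\<^sup>+v\<in>{1..}. ennreal (v powr (b - 1) * \<Phi> v) \<partial>lborel)"
    proof (intro nn_integral_mono)
      fix v
      show "ennreal ?c * indicator {u / 2..u} v
          \<le> ennreal (v powr (b - 1) * \<Phi> v) * indicator {1..} v"
      proof (cases "v \<in> {u / 2..u}")
        case True
        have "(u / 2) powr b / u \<le> v powr b / v"
          using True False \<open>0 < b\<close> by (intro frac_le powr_mono2) auto
        moreover have "\<Phi> u \<le> \<Phi> v"
          using True False by (intro monotone_onD[OF anti]) auto
        ultimately have "?c \<le> v powr (b - 1) * \<Phi> v"
          using True False nonneg by (intro mult_mono) (auto simp: powr_diff)
        then show ?thesis using True False by (auto intro: ennreal_leI)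
      qed auto
    qed
    finally have "?c * (u / 2) \<le> I" using I by simp
    then have "u powr b * \<Phi> u \<le> 2 powr (b + 1) * I"
      using False by (simp add: powr_divide powr_add field_simps)
    then show ?thesis by simp
  qed
  moreover have "0 \<le> max (2 powr b * \<Phi> 0) (2 powr (b + 1) * I)"
    using I by (simp add: le_max_iff_disj)
  ultimately show ?thesis by blast
qed

section \<open>Integrated kernels\<close>

lemma integrated_kernel_mono: "t \<le> t' \<Longrightarrow> integrated_kernel h t x y \<le> integrated_kernel h t' x y"
  unfolding integrated_kernel_def by (intro nn_integral_mono) (auto split: split_indicator)

lemma borel_measurable_integrated_kernel:
  fixes m :: "'a::{metric_space, second_countable_topology} measure"
  assumes "semigroup_kernel m X P h"
  shows "integrated_kernel h t x \<in> borel_measurable borel"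
proof -
  have h: "(\<lambda>(t, x, y). h t x y) \<in>
      borel_measurable (restrict_space borel {0<..} \<Otimes>\<^sub>M (borel \<Otimes>\<^sub>M borel))"
    using assms by (simp add: semigroup_kernel_def)
  \<comment> \<open>The kernel is only measurable for positive times, so it is precomposed with a measurable map
    onto these that does not move the times in the domain of integration.\<close>
  have "(\<lambda>s. if 0 < s then s else 1) \<in> borel \<rightarrow>\<^sub>M restrict_space borel {0::real<..}"
    by (intro measurable_restrict_space2) auto
  then have [measurable]: "(\<lambda>z. if 0 < snd z then snd z else 1)
      \<in> (borel \<Otimes>\<^sub>M borel :: ('a \<times> real) measure) \<rightarrow>\<^sub>M restrict_space borel {0<..}"
    by (rule measurable_compose[OF measurable_snd])
  have "(\<lambda>z. (if 0 < snd z then snd z else 1, x, fst z))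
      \<in> (borel \<Otimes>\<^sub>M borel :: ('a \<times> real) measure)
        \<rightarrow>\<^sub>M restrict_space borel {0<..} \<Otimes>\<^sub>M (borel \<Otimes>\<^sub>M borel)"
    by measurable
  from measurable_compose[OF this h]
  have [measurable]: "(\<lambda>z. h (if 0 < snd z then snd z else 1) x (fst z))
      \<in> borel_measurable (borel \<Otimes>\<^sub>M lborel)"
    by (simp add: measurable_cong_sets[OF sets_pair_measure_cong[OF refl sets_lborel] refl])
  have "(\<lambda>y. \<integral>\<^sup>+s. ennreal (h (if 0 < s then s else 1) x y) * indicator {0<..<t} s \<partial>lborel)
      \<in> borel_measurable borel"
    by (rule lborel.borel_measurable_nn_integral) (simp add: split_beta')
  also have "(\<lambda>y. \<integral>\<^sup>+s. ennreal (h (if 0 < s then s else 1) x y) * indicator {0<..<t} s \<partial>lborel)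
      = integrated_kernel h t x"
    unfolding integrated_kernel_def
    by (intro ext nn_integral_cong) (auto split: split_indicator)
  finally show ?thesis .
qed

lemma nn_integral_powr_from_0:
  fixes e t :: real
  assumes "0 < e" "0 < t"
  shows "(\<integral>\<^sup>+s\<in>{0<..<t}. ennreal (s powr (e - 1)) \<partial>lborel) \<le> ennreal (t powr e / e)"
proof -
  have "(\<integral>\<^sup>+s\<in>{0<..<t}. ennreal (s powr (e - 1)) \<partial>lborel)
      \<le> (\<integral>\<^sup>+s\<in>{0..t}. ennreal (s powr (e - 1)) \<partial>lborel)"
    by (intro nn_integral_mono) (auto split: split_indicator)
  also have "\<dots> = ennreal (t powr e / e)"
    using has_integral_powr_from_0[of "e - 1" t] assms
    by (intro nn_integral_has_integral_lebesgue') auto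
  finally show ?thesis .
qed

text \<open>The exponents \<open>b\<close> for which \<open>u powr b * \<Phi> u\<close> is bounded form an interval, and each of them
  trades decay in space for smallness in time: the larger \<open>b\<close>, the higher the power \<open>e\<close> of \<open>t\<close> in
  the bound and the stronger its singularity on the diagonal.\<close>

lemma integrated_kernel_le:
  fixes h :: "real \<Rightarrow> 'a::metric_space \<Rightarrow> 'a \<Rightarrow> real"
  assumes bound: "\<And>s. 0 < s \<Longrightarrow> ereal s < t0 \<Longrightarrow>
        h s x y \<le> 1 / s powr (\<nu> / \<beta>) * \<Phi> (dist x y / s powr (1 / \<beta>))"
    and M: "\<And>u. 0 \<le> u \<Longrightarrow> u powr b * \<Phi> u \<le> M" and "0 \<le> M" and "0 < \<beta>"
    and e: "e = 1 + (b - \<nu>) / \<beta>" "0 < e"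
    and t: "0 < t" "ereal t < t0" and "x \<noteq> y"
  shows "integrated_kernel h t x y \<le> ennreal (M / e * t powr e * dist x y powr - b)"
proof -
  let ?d = "dist x y"
  have d: "0 < ?d" using \<open>x \<noteq> y\<close> by simp
  have "h s x y \<le> M * ?d powr - b * s powr (e - 1)" if s: "0 < s" "s < t" for s
  proof -
    define u where "u = ?d / s powr (1 / \<beta>)"
    have u: "0 < u" using d s by (simp add: u_def)
    have ub: "u powr b = ?d powr b / s powr (b / \<beta>)"
      using d s by (simp add: u_def powr_divide powr_powr)
    have "h s x y \<le> 1 / s powr (\<nu> / \<beta>) * \<Phi> u"
      unfolding u_def using s t by (intro bound) (auto intro: less_trans[of _ "ereal t"])
    also have "\<dots> \<le> 1 / s powr (\<nu> / \<beta>) * (M * u powr - b)"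
      using M[of u] u by (intro mult_left_mono) (auto simp: powr_minus field_simps)
    also have "\<dots> = M * ?d powr - b * s powr (e - 1)"
      using d s by (simp add: powr_minus ub e diff_divide_distrib powr_diff field_simps)
    finally show ?thesis .
  qed
  then have "integrated_kernel h t x y
      \<le> (\<integral>\<^sup>+s. ennreal (M * ?d powr - b) * (ennreal (s powr (e - 1)) * indicator {0<..<t} s) \<partial>lborel)"
    unfolding integrated_kernel_def using \<open>0 \<le> M\<close>
    by (intro nn_integral_mono) (auto split: split_indicator simp: ennreal_mult[symmetric] intro!: ennreal_leI)
  also have "\<dots> \<le> ennreal (M * ?d powr - b) * ennreal (t powr e / e)"
    using nn_integral_powr_from_0[OF e(2) t(1)] by (subst nn_integral_cmult) (auto intro: mult_left_mono)
  also have "\<dots> = ennreal (M / e * t powr e * ?d powr - b)"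
    using \<open>0 \<le> M\<close> e(2) by (simp add: ennreal_mult[symmetric] mult_ac)
  finally show ?thesis .
qed

section \<open>Small-time order of the norms of integrated kernels\<close>

definition kernel_power_order ::
  "(real \<Rightarrow> 'a \<Rightarrow> 'a \<Rightarrow> real) \<Rightarrow> 'a measure \<Rightarrow> real \<Rightarrow> real \<Rightarrow> ('a \<Rightarrow> 'a set) \<Rightarrow> bool" where
  "kernel_power_order h \<mu> p a S \<longleftrightarrow>
     (\<exists>K\<ge>0. \<forall>\<^sub>F t in at_right 0. \<forall>x.
        (\<integral>\<^sup>+y\<in>S x. ennreal_powr (integrated_kernel h t x y) p \<partial>\<mu>) \<le> ennreal (K * t powr a))"

lemma kernel_power_order_antimono:
  assumes "kernel_power_order h \<mu> p a S" and "a' \<le> a"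
  shows "kernel_power_order h \<mu> p a' S"
proof -
  obtain K where K: "0 \<le> K" "\<forall>\<^sub>F t in at_right 0. \<forall>x.
      (\<integral>\<^sup>+y\<in>S x. ennreal_powr (integrated_kernel h t x y) p \<partial>\<mu>) \<le> ennreal (K * t powr a)"
    using assms(1) unfolding kernel_power_order_def by blast
  have "\<forall>\<^sub>F t in at_right 0. \<forall>x.
      (\<integral>\<^sup>+y\<in>S x. ennreal_powr (integrated_kernel h t x y) p \<partial>\<mu>) \<le> ennreal (K * t powr a')"
    using K(2) eventually_at_right_real[of 0 1, OF zero_less_one]
  proof eventually_elim
    case (elim t)
    have "K * t powr a \<le> K * t powr a'"
      using elim K(1) \<open>a' \<le> a\<close> by (intro mult_left_mono powr_mono') auto
    then show ?case using elim by (meson ennreal_leI order_trans)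
  qed
  then show ?thesis unfolding kernel_power_order_def using K(1) by blast
qed

lemma mem_S_K_if_near_far:
  fixes \<mu> :: "'a::metric_space measure"
  assumes radon: "radon_measure \<mu>" and p: "0 < p"
    and meas: "\<And>t x. integrated_kernel h t x \<in> borel_measurable borel"
    and near: "kernel_power_order h \<mu> p (p * \<delta>) (\<lambda>x. ball x R)"
    and far: "kernel_power_order h \<mu> p (p * \<delta>) (\<lambda>x. - ball x R)"
  shows "\<mu> \<in> S_K h p \<delta>"
proof -
  have sets: "sets \<mu> = sets borel" using radon by (simp add: radon_measure_def)
  have [measurable]: "integrated_kernel h t x \<in> borel_measurable \<mu>" for t x
    using meas by (simp add: measurable_cong_sets[OF sets refl])
  have [measurable]: "ball x R \<in> sets \<mu>" "- ball x R \<in> sets \<mu>" for x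
    by (auto simp: sets)
  let ?g = "\<lambda>t x y. ennreal_powr (integrated_kernel h t x y) p"
  obtain K1 where K1: "0 \<le> K1"
      "\<forall>\<^sub>F t in at_right 0. \<forall>x. (\<integral>\<^sup>+y\<in>ball x R. ?g t x y \<partial>\<mu>) \<le> ennreal (K1 * t powr (p * \<delta>))"
    using near unfolding kernel_power_order_def by blast
  obtain K2 where K2: "0 \<le> K2"
      "\<forall>\<^sub>F t in at_right 0. \<forall>x. (\<integral>\<^sup>+y\<in>- ball x R. ?g t x y \<partial>\<mu>) \<le> ennreal (K2 * t powr (p * \<delta>))"
    using far unfolding kernel_power_order_def by blast
  have "\<forall>\<^sub>F t in at_right 0. (SUP x. ennreal_powr (\<integral>\<^sup>+y. ?g t x y \<partial>\<mu>) (1 / p))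
      \<le> ennreal ((K1 + K2) powr (1 / p) * t powr \<delta>)"
    using K1(2) K2(2)
  proof eventually_elim
    case (elim t)
    show ?case
    proof (rule SUP_least)
      fix x
      have "(\<integral>\<^sup>+y. ?g t x y \<partial>\<mu>)
          = (\<integral>\<^sup>+y. ?g t x y * indicator (ball x R) y + ?g t x y * indicator (- ball x R) y \<partial>\<mu>)"
        by (intro nn_integral_cong) (auto split: split_indicator)
      also have "\<dots> = (\<integral>\<^sup>+y\<in>ball x R. ?g t x y \<partial>\<mu>) + (\<integral>\<^sup>+y\<in>- ball x R. ?g t x y \<partial>\<mu>)"
        by (intro nn_integral_add) measurable
      also have "\<dots> \<le> ennreal (K1 * t powr (p * \<delta>)) + ennreal (K2 * t powr (p * \<delta>))"
        using elim by (intro add_mono) auto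
      also have "\<dots> = ennreal ((K1 + K2) * t powr (p * \<delta>))"
        using K1 K2 by (simp add: ennreal_plus[symmetric] distrib_right del: ennreal_plus)
      finally have "ennreal_powr (\<integral>\<^sup>+y. ?g t x y \<partial>\<mu>) (1 / p)
          \<le> ennreal_powr (ennreal ((K1 + K2) * t powr (p * \<delta>))) (1 / p)"
        using p by (intro ennreal_powr_mono) auto
      also have "\<dots> = ennreal ((K1 + K2) powr (1 / p) * t powr \<delta>)"
        using K1 K2 p by (simp add: powr_mult powr_powr)
      finally show "ennreal_powr (\<integral>\<^sup>+y. ?g t x y \<partial>\<mu>) (1 / p)
          \<le> ennreal ((K1 + K2) powr (1 / p) * t powr \<delta>)" .
    qed
  qed
  then show ?thesis unfolding S_K_def using radon by blast
qed

lemma eventually_time_below: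
  assumes "0 < (t0::ereal)"
  shows "\<forall>\<^sub>F t in at_right 0. 0 < t \<and> ereal t < t0"
proof -
  obtain T where T: "0 < T" "ereal T < t0"
    using ereal_dense2[OF assms] by (auto simp: zero_ereal_def)
  from eventually_at_right_real[OF T(1)] show ?thesis
    by eventually_elim (use T(2) in \<open>auto intro: less_trans[of _ "ereal T"]\<close>)
qed

text \<open>The pointwise bound is integrated directly whenever the corresponding power of the distance is
  uniformly integrable over the region considered.\<close>

lemma kernel_power_order_if_dist_powr_integrable:
  fixes h :: "real \<Rightarrow> 'a::{metric_space, second_countable_topology} \<Rightarrow> 'a \<Rightarrow> real"
  assumes sets: "sets \<mu> = sets borel" and S: "\<And>x. S x \<in> sets borel"
    and bound: "\<And>x y s. 0 < s \<Longrightarrow> ereal s < t0 \<Longrightarrow>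
        h s x y \<le> 1 / s powr (\<nu> / \<beta>) * \<Phi> (dist x y / s powr (1 / \<beta>))"
    and M: "0 \<le> M" "\<And>u. 0 \<le> u \<Longrightarrow> u powr b * \<Phi> u \<le> M"
    and pos: "0 < t0" "0 < \<beta>" "0 < p"
    and e: "e = 1 + (b - \<nu>) / \<beta>" "0 < e"
    and null: "\<And>x. emeasure \<mu> {x} = 0"
    and L: "\<And>x. (\<integral>\<^sup>+y\<in>S x. ennreal (dist x y powr - (p * b)) \<partial>\<mu>) \<le> ennreal L"
  shows "kernel_power_order h \<mu> p (p * e) S"
proof -
  let ?K = "(M / e) powr p * max 0 L"
  have [measurable]: "S x \<in> sets \<mu>" for x using S sets by simp
  have [measurable]: "(\<lambda>y. dist x y) \<in> borel_measurable \<mu>" for x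
    unfolding measurable_cong_sets[OF sets refl] by measurable
  have "\<forall>\<^sub>F t in at_right 0. \<forall>x.
      (\<integral>\<^sup>+y\<in>S x. ennreal_powr (integrated_kernel h t x y) p \<partial>\<mu>) \<le> ennreal (?K * t powr (p * e))"
    using eventually_time_below[OF pos(1)]
  proof eventually_elim
    case (elim t)
    show ?case
    proof
      fix x
      let ?c = "(M / e) powr p * t powr (p * e)"
      have "AE y in \<mu>. y \<noteq> x"
        using null[of x] by (intro AE_I[where N = "{x}"]) (auto simp: sets)
      then have "AE y in \<mu>. ennreal_powr (integrated_kernel h t x y) p * indicator (S x) y
          \<le> ennreal ?c * (ennreal (dist x y powr - (p * b)) * indicator (S x) y)"
      proof eventually_elim
        case (elim y)
        have "0 \<le> M / e" using M e by simp
        have "ennreal_powr (integrated_kernel h t x y) p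
            \<le> ennreal_powr (ennreal (M / e * t powr e * dist x y powr - b)) p"
          using pos M e \<open>0 < t \<and> ereal t < t0\<close> elim
          by (intro ennreal_powr_mono integrated_kernel_le[where \<Phi> = \<Phi>, OF bound]) auto
        also have "\<dots> = ennreal (?c * dist x y powr - (p * b))"
          using \<open>0 \<le> M / e\<close>
          by (simp add: powr_mult powr_powr mult_ac del: times_divide_eq_left times_divide_eq_right)
        also have "\<dots> = ennreal ?c * ennreal (dist x y powr - (p * b))"
          by (simp add: ennreal_mult)
        finally show ?case by (auto split: split_indicator)
      qed
      then have "(\<integral>\<^sup>+y\<in>S x. ennreal_powr (integrated_kernel h t x y) p \<partial>\<mu>)
          \<le> (\<integral>\<^sup>+y. ennreal ?c * (ennreal (dist x y powr - (p * b)) * indicator (S x) y) \<partial>\<mu>)"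
        by (rule nn_integral_mono_AE)
      also have "\<dots> \<le> ennreal ?c * ennreal (max 0 L)"
        using L[of x] by (subst nn_integral_cmult) (auto intro: mult_left_mono)
      also have "\<dots> = ennreal (?K * t powr (p * e))"
        by (subst ennreal_mult[symmetric]) (simp_all add: mult_ac)
      finally show "(\<integral>\<^sup>+y\<in>S x. ennreal_powr (integrated_kernel h t x y) p \<partial>\<mu>)
          \<le> ennreal (?K * t powr (p * e))" .
    qed
  qed
  moreover have "0 \<le> ?K" by simp
  ultimately show ?thesis unfolding kernel_power_order_def by blast
qed

text \<open>Away from the diagonal the integrated kernel is uniformly small, so all but one of its \<open>p\<close>
  factors can be estimated pointwise; membership in \<^term>\<open>S_D h\<close> controls the integral of the last
  one.\<close>

lemma kernel_power_order_far_if_S_D: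
  fixes h :: "real \<Rightarrow> 'a::metric_space \<Rightarrow> 'a \<Rightarrow> real"
  assumes S_D: "\<mu> \<in> S_D h"
    and meas: "\<And>t x. integrated_kernel h t x \<in> borel_measurable borel"
    and bound: "\<And>x y s. 0 < s \<Longrightarrow> ereal s < t0 \<Longrightarrow>
        h s x y \<le> 1 / s powr (\<nu> / \<beta>) * \<Phi> (dist x y / s powr (1 / \<beta>))"
    and M: "0 \<le> M" "\<And>u. 0 \<le> u \<Longrightarrow> u powr b * \<Phi> u \<le> M"
    and pos: "0 < t0" "0 < \<beta>" "1 \<le> p" "0 < R" "0 \<le> b"
    and e: "e = 1 + (b - \<nu>) / \<beta>" "0 < e"
  shows "kernel_power_order h \<mu> p ((p - 1) * e) (\<lambda>x. - ball x R)"
proof -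
  have sets: "sets \<mu> = sets borel" using S_D by (simp add: S_D_def radon_measure_def)
  have [measurable]: "integrated_kernel h t x \<in> borel_measurable \<mu>" for t x
    using meas by (simp add: measurable_cong_sets[OF sets refl])
  obtain t1 where t1: "0 < t1" "(SUP x. \<integral>\<^sup>+y. integrated_kernel h t1 x y \<partial>\<mu>) < \<infinity>"
    using S_D by (auto simp: S_D_def)
  then obtain D where D: "0 \<le> D" "(SUP x. \<integral>\<^sup>+y. integrated_kernel h t1 x y \<partial>\<mu>) = ennreal D"
    by (cases "SUP x. \<integral>\<^sup>+y. integrated_kernel h t1 x y \<partial>\<mu>") auto
  define A where "A = M / e * R powr - b"
  have A: "0 \<le> A" using M e by (simp add: A_def)
  have "\<forall>\<^sub>F t in at_right 0. \<forall>x. (\<integral>\<^sup>+y\<in>- ball x R. ennreal_powr (integrated_kernel h t x y) p \<partial>\<mu>)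
      \<le> ennreal (A powr (p - 1) * D * t powr ((p - 1) * e))"
    using eventually_time_below[OF pos(1)] eventually_at_right_real[OF t1(1)]
  proof eventually_elim
    case (elim t)
    show ?case
    proof
      fix x
      let ?c = "(A * t powr e) powr (p - 1)"
      have "(\<integral>\<^sup>+y\<in>- ball x R. ennreal_powr (integrated_kernel h t x y) p \<partial>\<mu>)
          \<le> (\<integral>\<^sup>+y. ennreal ?c * integrated_kernel h t x y \<partial>\<mu>)"
      proof (intro nn_integral_mono)
        fix y
        show "ennreal_powr (integrated_kernel h t x y) p * indicator (- ball x R) y
            \<le> ennreal ?c * integrated_kernel h t x y"
        proof (cases "y \<in> - ball x R")
          case True
          then have xy: "x \<noteq> y" "R \<le> dist x y" using pos by auto
          have "integrated_kernel h t x y \<le> ennreal (M / e * t powr e * dist x y powr - b)"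
            using pos M e elim xy by (intro integrated_kernel_le[where \<Phi> = \<Phi>, OF bound]) auto
          also have "M / e * t powr e * dist x y powr - b \<le> M / e * t powr e * R powr - b"
            using pos M e xy by (intro mult_left_mono powr_mono2') auto
          finally have "integrated_kernel h t x y \<le> ennreal (A * t powr e)"
            by (simp add: A_def ennreal_leI mult_ac)
          then have "ennreal_powr (integrated_kernel h t x y) p \<le> ennreal ?c * integrated_kernel h t x y"
            using A pos by (intro ennreal_powr_le_linear) auto
          then show ?thesis using True by simp
        qed auto
      qed
      also have "\<dots> = ennreal ?c * (\<integral>\<^sup>+y. integrated_kernel h t x y \<partial>\<mu>)"
        by (rule nn_integral_cmult) measurable
      also have "(\<integral>\<^sup>+y. integrated_kernel h t x y \<partial>\<mu>) \<le> (\<integral>\<^sup>+y. integrated_kernel h t1 x y \<partial>\<mu>)"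
        using elim by (intro nn_integral_mono integrated_kernel_mono) auto
      also have "(\<integral>\<^sup>+y. integrated_kernel h t1 x y \<partial>\<mu>) \<le> ennreal D"
        unfolding D(2)[symmetric] by (rule SUP_upper) simp
      also have "ennreal ?c * ennreal D = ennreal (A powr (p - 1) * D * t powr ((p - 1) * e))"
        using A D by (simp add: ennreal_mult[symmetric] powr_mult powr_powr mult_ac)
      finally show "(\<integral>\<^sup>+y\<in>- ball x R. ennreal_powr (integrated_kernel h t x y) p \<partial>\<mu>)
          \<le> ennreal (A powr (p - 1) * D * t powr ((p - 1) * e))"
        by (simp add: mult_left_mono)
    qed
  qed
  moreover have "0 \<le> A powr (p - 1) * D" using D by simp
  ultimately show ?thesis unfolding kernel_power_order_def by blast
qed

section \<open>Membership in the classes of measures\<close>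

theorem theorem4p6:
  fixes m \<mu> :: "'a::{metric_space, second_countable_topology} measure"
    and \<F> :: "('a \<Rightarrow> real) set"
    and \<E> :: "('a \<Rightarrow> real) \<Rightarrow> ('a \<Rightarrow> real) \<Rightarrow> real"
    and N :: "'w measure"
    and X :: "ennreal \<Rightarrow> 'w \<Rightarrow> 'a option"
    and \<zeta> :: "'w \<Rightarrow> ennreal"
    and P :: "'a option \<Rightarrow> 'w measure"
    and h :: "real \<Rightarrow> 'a \<Rightarrow> 'a \<Rightarrow> real"
    and \<Phi> :: "real \<Rightarrow> real"
    and \<nu> \<beta> \<eta> p C r0 :: real
    and t0 :: ereal
  assumes "locally_compact_space (euclidean :: 'a topology)"
    and "radon_measure m" and "full_support m"
    and "symmetric_dirichlet_form m \<F> \<E>" and "regular_form m \<F> \<E>"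
    and "hunt_process N X \<zeta> P"
    and "associated_process m \<F> \<E> X P"
    and "semigroup_kernel m X P h"
    and "0 < \<nu>" and "0 < \<beta>" and "0 < t0" and "1 \<le> p"
    and "radon_measure \<mu>"
    and "0 < C" and "0 < r0"
    and "0 < \<eta>" and "\<eta> \<le> \<nu>" and "\<eta> - p * (\<nu> - \<beta>) > 0"
    and "\<And>x r. 0 < r \<Longrightarrow> r < r0 \<Longrightarrow> emeasure \<mu> (ball x r) \<le> ennreal (C * r powr \<eta>)"
    and "\<And>u. 0 \<le> u \<Longrightarrow> 0 < \<Phi> u"
    and "antimono_on {0..} \<Phi>"
    and "(\<integral>\<^sup>+u\<in>{1..}. ennreal (u powr (\<nu> - 1) * \<Phi> u) \<partial>lborel) < \<infinity>"
    and "\<And>x y t. 0 < t \<Longrightarrow> ereal t < t0 \<Longrightarrow>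
           h t x y \<le> 1 / t powr (\<nu> / \<beta>) * \<Phi> (dist x y / t powr (1 / \<beta>))"
  shows
    "(emeasure \<mu> UNIV < \<infinity> \<longrightarrow>
        (\<forall>\<delta>\<in>{0<..<(\<eta> - p * (\<nu> - \<beta>)) / (p * \<beta>)}. \<mu> \<in> S_K h p \<delta>))
     \<and>
     (1 < p \<and> \<mu> \<in> S_D h \<longrightarrow>
        ((\<eta> + \<beta>) / \<nu> \<le> p \<and> ereal p < div_pos_part \<eta> (\<nu> - \<beta>) \<longrightarrow>
           (\<forall>\<delta>\<in>{0<..<(\<eta> - p * (\<nu> - \<beta>)) / (p * \<beta>)}. \<mu> \<in> S_K h p \<delta>)) \<and>
        (p < (\<eta> + \<beta>) / \<nu> \<longrightarrow>
           (\<forall>\<delta>\<in>{0<..<((p - 1) * (\<eta> - p * (\<nu> - \<beta>))) / (p\<^sup>2 * \<beta>)}. \<mu> \<in> S_K h p \<delta>)))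
     \<and>
     (1 < p \<and> \<mu> \<in> S_D h \<and>
        ((\<exists>C'>0. \<forall>r>0. (SUP x. emeasure \<mu> (ball x r)) \<le> ennreal (C' * r powr \<eta>)) \<or>
         (\<forall>\<gamma>>0. (\<integral>\<^sup>+u\<in>{1..}. ennreal (u powr (\<nu> + \<gamma> - 1) * \<Phi> u) \<partial>lborel) < \<infinity>)) \<longrightarrow>
        (\<forall>\<delta>\<in>{0<..<(\<eta> - p * (\<nu> - \<beta>)) / (p * \<beta>)}. \<mu> \<in> S_K h p \<delta>))"
proof -
  define \<delta>' where "\<delta>' = (\<eta> - p * (\<nu> - \<beta>)) / (p * \<beta>)"
  define R where "R = r0 / 2"
  note bound = assms(23)
  have pos: "0 < \<nu>" "0 < \<beta>" "0 < t0" "1 \<le> p" "0 < p" "0 < C" "0 < R" "R < r0" "0 < \<eta>" "\<eta> \<le> \<nu>"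
    using assms by (auto simp: R_def)
  have sets: "sets \<mu> = sets borel" using assms(13) by (simp add: radon_measure_def)
  have meas: "integrated_kernel h t x \<in> borel_measurable borel" for t x
    by (rule borel_measurable_integrated_kernel[OF assms(8)])
  have null: "emeasure \<mu> {x} = 0" for x
    using pos assms(15,19) by (intro emeasure_singleton_eq_0_if_ball_growth[OF sets, of r0 \<eta> _ C]) auto
  have decay: "\<exists>M\<ge>0. \<forall>u\<ge>0. u powr b * \<Phi> u \<le> M"
    if "0 < b" "(\<integral>\<^sup>+u\<in>{1..}. ennreal (u powr (b - 1) * \<Phi> u) \<partial>lborel) < \<infinity>" for b
    using that assms(20,21) by (intro antimono_integrable_imp_powr_bound) (auto intro: less_imp_le)
  obtain M where M: "0 \<le> M" "\<And>u. 0 \<le> u \<Longrightarrow> u powr \<nu> * \<Phi> u \<le> M"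
    using decay[OF pos(1) assms(22)] by blast
  have pd: "p * \<delta>' = (\<eta> - p * \<nu>) / \<beta> + p"
    using pos by (simp add: \<delta>'_def field_simps)
  have \<delta>'_pos: "0 < \<delta>'" using pos assms(18) by (simp add: \<delta>'_def)
  have "\<eta> \<le> p * \<nu>" using pos mult_right_mono[of 1 p \<nu>] by linarith
  then have "p * \<delta>' \<le> p * 1" using pos pd by (simp add: divide_le_0_iff)
  then have \<delta>'_le: "\<delta>' \<le> 1" using pos by simp

  have near: "kernel_power_order h \<mu> p (p * \<delta>) (\<lambda>x. ball x R)" if "0 < \<delta>" "\<delta> < \<delta>'" for \<delta>
  proof -
    \<comment> \<open>The spatial exponent \<open>b\<close> is determined by the power of \<open>t\<close> wanted; it has to be nonnegative
      because \<open>\<Phi>\<close> is bounded below near 0, where a negative power is unbounded;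
      hence the passage from \<open>\<delta>\<close> to a possibly larger \<open>e\<close>.\<close>
    define e where "e = max \<delta> (1 - \<nu> / \<beta>)"
    define b where "b = \<nu> - \<beta> * (1 - e)"
    have "1 - \<nu> / \<beta> < \<delta>'"
      using pos by (simp add: \<delta>'_def field_simps)
    then have e: "0 < e" "e < \<delta>'" "\<delta> \<le> e" using that by (auto simp: e_def)
    have "1 - \<nu> / \<beta> \<le> e" by (simp add: e_def)
    then have "0 \<le> b" using pos by (simp add: b_def field_simps)
    have e_eq: "e = 1 + (b - \<nu>) / \<beta>" using pos by (simp add: b_def)
    have "\<beta> * (p * e) < \<beta> * (p * \<delta>')" using e pos by simp
    moreover have "\<beta> * (p * \<delta>') = \<eta> - p * \<nu> + \<beta> * p"
      using pos by (simp add: pd distrib_left)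
    moreover have "p * b = p * \<nu> - \<beta> * p + \<beta> * (p * e)"
      by (simp add: b_def algebra_simps)
    ultimately have pb: "p * b < \<eta>" by linarith
    have "e \<le> 1" using e \<delta>'_le by simp
    then have "b \<le> \<nu>" using pos by (simp add: b_def)
    have Mb: "u powr b * \<Phi> u \<le> max M (\<Phi> 0)" if "0 \<le> u" for u
    proof (cases "u \<le> 1")
      case True
      have "u powr b * \<Phi> u \<le> 1 * \<Phi> 0"
        using True that \<open>0 \<le> b\<close> assms(20)[of u] monotone_onD[OF assms(21), of 0 u]
        by (intro mult_mono powr_le1) auto
      then show ?thesis by simp
    next
      case False
      have "u powr b * \<Phi> u \<le> u powr \<nu> * \<Phi> u"
        using False \<open>b \<le> \<nu>\<close> assms(20)[of u] by (intro mult_right_mono powr_mono) auto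
      then show ?thesis using M(2)[OF that] by simp
    qed
    have "\<exists>L. \<forall>x. (\<integral>\<^sup>+y\<in>ball x R. ennreal (dist x y powr - (p * b)) \<partial>\<mu>) \<le> ennreal L"
      using pos pb \<open>0 \<le> b\<close> assms(19)
      by (intro nn_integral_dist_powr_ball[OF sets, of R r0 C _ \<eta>]) auto
    then obtain L where "\<And>x. (\<integral>\<^sup>+y\<in>ball x R. ennreal (dist x y powr - (p * b)) \<partial>\<mu>) \<le> ennreal L"
      by blast
    then have "kernel_power_order h \<mu> p (p * e) (\<lambda>x. ball x R)"
      using pos M(1) e e_eq null Mb
      by (intro kernel_power_order_if_dist_powr_integrable[OF sets _ bound, where M = "max M (\<Phi> 0)"]) auto
    then show ?thesis
      using e pos by (elim kernel_power_order_antimono) auto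
  qed
  have S_K_I: "\<mu> \<in> S_K h p \<delta>"
    if "0 < \<delta>" "\<delta> < \<delta>'" "kernel_power_order h \<mu> p a (\<lambda>x. - ball x R)" "p * \<delta> \<le> a" for \<delta> a
    using mem_S_K_if_near_far[OF assms(13) pos(5) meas near kernel_power_order_antimono] that by blast
  have far_if_integrable: "kernel_power_order h \<mu> p p (\<lambda>x. - ball x R)"
    if "\<And>x. (\<integral>\<^sup>+y\<in>- ball x R. ennreal (dist x y powr - (p * \<nu>)) \<partial>\<mu>) \<le> ennreal L" for L
    using kernel_power_order_if_dist_powr_integrable[OF sets _ bound M pos(3,2,5) refl _ null that] by simp
  have far_if_S_D: "kernel_power_order h \<mu> p (p - 1) (\<lambda>x. - ball x R)" if "\<mu> \<in> S_D h"
    using kernel_power_order_far_if_S_D[OF that meas bound M pos(3,2,4,7) _ refl] pos by simp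

  have finite_case: "\<mu> \<in> S_K h p \<delta>" if "emeasure \<mu> UNIV < \<infinity>" "0 < \<delta>" "\<delta> < \<delta>'" for \<delta>
  proof -
    obtain V where V: "0 \<le> V" "emeasure \<mu> UNIV = ennreal V"
      using \<open>emeasure \<mu> UNIV < \<infinity>\<close> by (cases "emeasure \<mu> UNIV") auto
    have "(\<integral>\<^sup>+y\<in>- ball x R. ennreal (dist x y powr - (p * \<nu>)) \<partial>\<mu>) \<le> ennreal (R powr - (p * \<nu>) * V)" for x
    proof -
      have "(\<integral>\<^sup>+y\<in>- ball x R. ennreal (dist x y powr - (p * \<nu>)) \<partial>\<mu>)
          \<le> (\<integral>\<^sup>+y. ennreal (R powr - (p * \<nu>)) \<partial>\<mu>)"
        using pos by (intro nn_integral_mono) (auto split: split_indicator intro!: ennreal_leI powr_mono2')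
      also have "\<dots> = ennreal (R powr - (p * \<nu>) * V)"
        using V sets_eq_imp_space_eq[OF sets] by (simp add: ennreal_mult)
      finally show ?thesis .
    qed
    from far_if_integrable[OF this] show ?thesis
      using that \<delta>'_le pos by (intro S_K_I) auto
  qed

  have S_D_case: "\<mu> \<in> S_K h p \<delta>" if "\<mu> \<in> S_D h" "0 < \<delta>" "\<delta> < \<delta>'" "p * \<delta> \<le> p - 1" for \<delta>
    using S_K_I[OF that(2,3) far_if_S_D[OF that(1)] that(4)] .

  have large_p: "\<mu> \<in> S_K h p \<delta>"
    if "\<mu> \<in> S_D h" "(\<eta> + \<beta>) / \<nu> \<le> p" "0 < \<delta>" "\<delta> < \<delta>'" for \<delta>
  proof -
    have "p * \<delta>' \<le> p - 1"
      using that(2) pos unfolding pd by (simp add: field_simps)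
    moreover have "p * \<delta> \<le> p * \<delta>'" using that pos by simp
    ultimately show ?thesis using that by (intro S_D_case) auto
  qed

  have small_p: "\<mu> \<in> S_K h p \<delta>"
    if "1 < p" "\<mu> \<in> S_D h" "0 < \<delta>" "\<delta> < ((p - 1) * (\<eta> - p * (\<nu> - \<beta>))) / (p\<^sup>2 * \<beta>)" for \<delta>
  proof -
    have "((p - 1) * (\<eta> - p * (\<nu> - \<beta>))) / (p\<^sup>2 * \<beta>) = (p - 1) * \<delta>' / p"
      by (simp add: \<delta>'_def power2_eq_square)
    then have "\<delta> < (p - 1) * \<delta>' / p" using that(4) by linarith
    then have *: "p * \<delta> < (p - 1) * \<delta>'" using pos by (simp add: pos_less_divide_eq mult.commute)
    have "(p - 1) * \<delta>' \<le> p - 1" using that \<delta>'_le by (simp add: mult_left_le)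
    then have "p * \<delta> \<le> p - 1" using * by linarith
    moreover have "(p - 1) * \<delta>' \<le> p * \<delta>'" using \<delta>'_pos by simp
    then have "p * \<delta> < p * \<delta>'" using * by linarith
    then have "\<delta> < \<delta>'" using pos by simp
    ultimately show ?thesis using that by (intro S_D_case)
  qed

  have growth_case: "\<mu> \<in> S_K h p \<delta>"
    if "1 < p" "0 < C'" "\<forall>r>0. (SUP x. emeasure \<mu> (ball x r)) \<le> ennreal (C' * r powr \<eta>)"
      "0 < \<delta>" "\<delta> < \<delta>'" for \<delta> C'
  proof -
    have "1 * \<nu> < p * \<nu>" using that pos by (intro mult_strict_right_mono) auto
    then have "\<eta> < p * \<nu>" using pos by linarith
    moreover have "emeasure \<mu> (ball x r) \<le> ennreal (C' * r powr \<eta>)" if "0 < r" for x r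
      using \<open>\<forall>r>0. _\<close> that by (meson SUP_upper UNIV_I order_trans)
    ultimately have "\<exists>L. \<forall>x. (\<integral>\<^sup>+y\<in>- ball x R. ennreal (dist x y powr - (p * \<nu>)) \<partial>\<mu>) \<le> ennreal L"
      using pos that(2) by (intro nn_integral_dist_powr_outside_ball[OF sets, of R C' _ \<eta>]) auto
    then obtain L where "\<And>x. (\<integral>\<^sup>+y\<in>- ball x R. ennreal (dist x y powr - (p * \<nu>)) \<partial>\<mu>) \<le> ennreal L"
      by blast
    from far_if_integrable[OF this] show ?thesis
      using that \<delta>'_le pos by (intro S_K_I) auto
  qed

  have moment_case: "\<mu> \<in> S_K h p \<delta>"
    if "1 < p" "\<mu> \<in> S_D h"
      "\<forall>\<gamma>>0. (\<integral>\<^sup>+u\<in>{1..}. ennreal (u powr (\<nu> + \<gamma> - 1) * \<Phi> u) \<partial>lborel) < \<infinity>"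
      "0 < \<delta>" "\<delta> < \<delta>'" for \<delta>
  proof -
    \<comment> \<open>This choice makes \<open>(p - 1) * (1 + \<gamma> / \<beta>)\<close> equal to \<open>p\<close>.\<close>
    define \<gamma> where "\<gamma> = \<beta> / (p - 1)"
    have \<gamma>: "0 < \<gamma>" using that pos by (simp add: \<gamma>_def)
    then have "\<exists>M\<ge>0. \<forall>u\<ge>0. u powr (\<nu> + \<gamma>) * \<Phi> u \<le> M"
      using that(3) pos by (intro decay) auto
    then obtain M' where M': "0 \<le> M'" "\<And>u. 0 \<le> u \<Longrightarrow> u powr (\<nu> + \<gamma>) * \<Phi> u \<le> M'"
      by blast
    have e: "1 + 1 / (p - 1) = 1 + (\<nu> + \<gamma> - \<nu>) / \<beta>"
      using pos by (simp add: \<gamma>_def)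
    have "kernel_power_order h \<mu> p ((p - 1) * (1 + 1 / (p - 1))) (\<lambda>x. - ball x R)"
      using pos \<gamma> that by (intro kernel_power_order_far_if_S_D[OF that(2) meas bound M' _ _ _ _ _ e])
        (auto intro: add_pos_pos)
    moreover have "(p - 1) * (1 + 1 / (p - 1)) = p"
      using that by (simp add: field_simps)
    ultimately show ?thesis
      using that \<delta>'_le pos by (intro S_K_I) auto
  qed

  show ?thesis
    unfolding \<delta>'_def[symmetric]
    using finite_case large_p small_p growth_case moment_case by auto
qed

end
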